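(* Let $m\ge1$ be an integer, $\rho>0$, and let $n_*>m$ be an integer. For the $M/M/m$ queue length process $N(t)$ let $\tau(n_* )=\min\{t:N(t)=n_*\}$ and $\widehat Q_n(\theta)=E\left[e^{-\theta\tau(n_* )}\mid N(0)=n\right]$ for $\mathrm{Re}(\theta)>0$, $0\le n\le n_*$. Set $$Z_\pm=Z_\pm(\theta)=\frac1{2\rho}\left[\rho+\theta+m\pm\sqrt{(\rho+\theta+m)^2-4\rho m}\right].$$ Then, writing $F_n=F_n(\theta)$, $$\widehat Q_n(\theta)=\rho^{m-n}\frac{n!}{m!}\,\frac{\sqrt{(\theta+m+\rho)^2-4m\rho}\;F_n(\theta)}{\rho F_m\left(Z_+Z_-^{n_*-m}-Z_-Z_+^{n_*-m}\right)+(m+1)F_{m+1}\left(Z_+^{n_*-m}-Z_-^{n_*-m}\right)},\qquad 0\le n\le m,$$ and $$\widehat Q_n(\theta)=\frac{\rho F_m\left(Z_+Z_-^{n-m}-Z_-Z_+^{n-m}\right)+(m+1)F_{m+1}\left(Z_+^{n-m}-Z_-^{n-m}\right)}{\rho F_m\left(Z_+Z_-^{n_*-m}-Z_-Z_+^{n_*-m}\right)+(m+1)F_{m+1}\left(Z_+^{n_*-m}-Z_-^{n_*-m}\right)},\qquad m\le n\le n_*.$$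
   Context: The $M/M/m$ model with service rate $\mu=1$: $N(t)$ is the birth–death process on $\{0,1,2,\dots\}$ with birth rate $\rho$ in every state and death rate $\min\{n,m\}$ in state $n$. The square root is the branch analytic in $\mathrm{Re}(\theta)>0$ that is positive for $\theta>0$. For integer $n\ge0$, $$F_n(\theta)=\frac{1}{2\pi i}\int_{C_0}\frac{e^{\rho z}}{z^{n+1}(1-z)^\theta}\,dz=\sum_{\ell=0}^n\frac{\rho^{n-\ell}}{(n-\ell)!\,\ell!}\frac{\Gamma(\theta+\ell)}{\Gamma(\theta)},$$ where $C_0$ is a small counterclockwise circle about $0$ inside $|z|<1$ and $(1-z)^\theta=|1-z|^\theta e^{i\theta\arg(1-z)}$, $|\arg(1-z)|<\pi$. *)

theory Defs
  imports "HOL-Probability.Probability" "HOL-Complex_Analysis.Complex_Analysis"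
begin

definition transition_function :: "(real \<Rightarrow> nat \<Rightarrow> nat \<Rightarrow> real) \<Rightarrow> bool" where
  "transition_function P \<longleftrightarrow>
     (\<forall>t\<ge>0. \<forall>i j. 0 \<le> P t i j) \<and>
     (\<forall>t\<ge>0. \<forall>i. (\<lambda>j. P t i j) sums 1) \<and>
     (\<forall>i j. P 0 i j = (if i = j then 1 else 0)) \<and>
     (\<forall>s\<ge>0. \<forall>t\<ge>0. \<forall>i j. (\<lambda>k. P s i k * P t k j) sums P (s + t) i j)"

definition birth_death_rate :: "(nat \<Rightarrow> real) \<Rightarrow> (nat \<Rightarrow> real) \<Rightarrow> nat \<Rightarrow> nat \<Rightarrow> real" where
  "birth_death_rate b d i j =
     (if j = Suc i then b i
      else if i = Suc j then d i
      else if i = j then - (b i + (if i = 0 then 0 else d i))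
      else 0)"

text \<open>
  \<open>P h i j = (if i = j then 1 else 0) + q i j * h + o(h)\<close> as \<open>h\<close> decreases to \<open>0\<close>.
\<close>

definition has_rates :: "(real \<Rightarrow> nat \<Rightarrow> nat \<Rightarrow> real) \<Rightarrow> (nat \<Rightarrow> nat \<Rightarrow> real) \<Rightarrow> bool" where
  "has_rates P q \<longleftrightarrow>
     (\<forall>i j. ((\<lambda>h. P h i j) has_real_derivative q i j) (at_right 0))"

text \<open>
  A time-homogeneous Markov process with an arbitrary initial distribution. Since
  \<^typ>\<open>nat\<close> carries the discrete topology, right-continuity says that the path stays
  constant for a positive time after each instant. Only times \<open>t \<ge> 0\<close> matter.
\<close>

definition markov_process ::
    "'w measure \<Rightarrow> (real \<Rightarrow> nat \<Rightarrow> nat \<Rightarrow> real) \<Rightarrow> (real \<Rightarrow> 'w \<Rightarrow> nat) \<Rightarrow> bool" where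
  "markov_process M P N \<longleftrightarrow>
     prob_space M \<and>
     (\<forall>t\<ge>0. N t \<in> measurable M (count_space UNIV)) \<and>
     (\<forall>\<omega>\<in>space M. \<forall>t\<ge>0. continuous (at_right t) (\<lambda>s. N s \<omega>)) \<and>
     (\<forall>(k::nat) (ts :: nat \<Rightarrow> real) (xs :: nat \<Rightarrow> nat).
        0 \<le> ts 0 \<longrightarrow> (\<forall>i\<le>k. ts i < ts (Suc i)) \<longrightarrow>
        measure M {\<omega>\<in>space M. \<forall>i\<le>k. N (ts i) \<omega> = xs i} > 0 \<longrightarrow>
        \<P>(\<omega> in M. N (ts (Suc k)) \<omega> = xs (Suc k) \<bar> \<forall>i\<le>k. N (ts i) \<omega> = xs i) =
          P (ts (Suc k) - ts k) (xs k) (xs (Suc k)))"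

text \<open>
  Meant for bounded rates, as below: then the rates determine the transition function and
  the paths almost surely do not explode, so nothing further has to be required.
\<close>

definition birth_death_process ::
    "'w measure \<Rightarrow> (nat \<Rightarrow> real) \<Rightarrow> (nat \<Rightarrow> real) \<Rightarrow> (real \<Rightarrow> 'w \<Rightarrow> nat) \<Rightarrow> bool" where
  "birth_death_process M b d N \<longleftrightarrow>
     (\<exists>P. transition_function P \<and> has_rates P (birth_death_rate b d) \<and> markov_process M P N)"

definition MMm_queue :: "'w measure \<Rightarrow> nat \<Rightarrow> real \<Rightarrow> (real \<Rightarrow> 'w \<Rightarrow> nat) \<Rightarrow> bool" where
  "MMm_queue M m \<rho> N \<longleftrightarrow> birth_death_process M (\<lambda>_. \<rho>) (\<lambda>n. real (min n m)) N"

text \<open>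
  The infimum is \<open>\<infinity>\<close> if the path never visits \<open>k\<close>; otherwise it is a minimum for
  right-continuous paths, see \<open>hitting_time_attained\<close> below.
\<close>

definition hitting_time :: "(real \<Rightarrow> 'w \<Rightarrow> nat) \<Rightarrow> nat \<Rightarrow> 'w \<Rightarrow> ereal" where
  "hitting_time N k \<omega> = (INF t\<in>{t. 0 \<le> t \<and> N t \<omega> = k}. ereal t)"

text \<open>\<open>exp (- \<theta> t)\<close>, with the value \<open>0\<close> at \<open>t = \<infinity>\<close> (appropriate for \<open>Re \<theta> > 0\<close>).\<close>

definition exp_discount :: "complex \<Rightarrow> ereal \<Rightarrow> complex" where
  "exp_discount \<theta> t = (if t = \<infinity> then 0 else exp (- \<theta> * complex_of_real (real_of_ereal t)))"

text \<open>
  \<open>uniform_measure M A\<close> is the conditional probability measure given the event \<open>A\<close>.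
\<close>

definition Q_hat ::
    "'w measure \<Rightarrow> (real \<Rightarrow> 'w \<Rightarrow> nat) \<Rightarrow> nat \<Rightarrow> nat \<Rightarrow> complex \<Rightarrow> complex" where
  "Q_hat M N k n \<theta> =
     (\<integral>\<omega>. exp_discount \<theta> (hitting_time N k \<omega>)
        \<partial>(uniform_measure M {\<omega>\<in>space M. N 0 \<omega> = n}))"

lemma hitting_time_attained:
  assumes "\<And>t. t \<ge> 0 \<Longrightarrow> continuous (at_right t) (\<lambda>s. N s \<omega>)"
    and "\<exists>t\<ge>0. N t \<omega> = k"
  shows "\<exists>t\<ge>0. N t \<omega> = k \<and> hitting_time N k \<omega> = ereal t"
proof -
  define A where "A = {t. 0 \<le> t \<and> N t \<omega> = k}"
  define t where "t = Inf A"
  have ne: "A \<noteq> {}" and bdd: "bdd_below A"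
    using assms(2) by (auto simp: A_def intro: bdd_belowI[of _ 0])
  have t0: "t \<ge> 0"
    unfolding t_def using ne by (intro cInf_greatest) (auto simp: A_def)
  have "((\<lambda>s. N s \<omega>) \<longlongrightarrow> N t \<omega>) (at_right t)"
    using assms(1)[OF t0] by (simp add: continuous_within)
  hence "eventually (\<lambda>s. N s \<omega> = N t \<omega>) (at_right t)"
    by (simp add: tendsto_discrete)
  then obtain b where b: "b > t" "\<And>s. t < s \<Longrightarrow> s < b \<Longrightarrow> N s \<omega> = N t \<omega>"
    unfolding eventually_at_right_field by blast
  obtain s where s: "s \<in> A" "s < b"
    using cInf_lessD[of A b] ne b(1) unfolding t_def by blast
  have "t \<le> s" unfolding t_def using s(1) bdd by (rule cInf_lower)
  hence Nt: "N t \<omega> = k" using b(2)[of s] s by (cases "s = t") (auto simp: A_def)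
  have "hitting_time N k \<omega> = ereal t"
    unfolding hitting_time_def A_def[symmetric]
  proof (rule antisym)
    show "(INF t\<in>A. ereal t) \<le> ereal t"
      by (rule INF_lower) (use t0 Nt in \<open>auto simp: A_def\<close>)
    show "ereal t \<le> (INF t\<in>A. ereal t)"
      by (rule INF_greatest) (auto simp: t_def intro: cInf_lower bdd)
  qed
  thus ?thesis using t0 Nt by blast
qed

text \<open>
  A property of \<open>S\<close> rather than a function: \<open>MMm_sqrt_exists\<close> and \<open>MMm_sqrt_unique\<close>
  below show that it pins down \<open>S\<close> on the right half-plane.
\<close>

definition MMm_sqrt :: "nat \<Rightarrow> real \<Rightarrow> (complex \<Rightarrow> complex) \<Rightarrow> bool" where
  "MMm_sqrt m \<rho> S \<longleftrightarrow>
     S holomorphic_on {\<theta>. Re \<theta> > 0} \<and>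
     (\<forall>\<theta>. Re \<theta> > 0 \<longrightarrow>
        (S \<theta>)\<^sup>2 = (\<theta> + of_nat m + of_real \<rho>)\<^sup>2 - 4 * of_nat m * of_real \<rho>) \<and>
     (\<forall>x>0. \<exists>y>0. S (complex_of_real x) = complex_of_real y)"

lemma MMm_sqrt_radicand:
  assumes "\<rho> > 0" "Re \<theta> > 0"
  shows "(\<theta> + of_nat m + of_real \<rho>)\<^sup>2 - 4 * of_nat m * of_real \<rho> \<notin> \<real>\<^sub>\<le>\<^sub>0"
proof
  define x y where "x = Re \<theta> + real m + \<rho>" and "y = Im \<theta>"
  have x: "x > 0" using assms by (simp add: x_def)
  have "4 * real m * \<rho> \<le> (real m + \<rho>)\<^sup>2"
    using zero_le_power2[of "real m - \<rho>"] by (simp add: power2_eq_square algebra_simps)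
  also have "\<dots> < x\<^sup>2"
    unfolding x_def using assms by (intro power_strict_mono) auto
  finally have less: "4 * real m * \<rho> < x\<^sup>2" .
  assume "(\<theta> + of_nat m + of_real \<rho>)\<^sup>2 - 4 * of_nat m * of_real \<rho> \<in> \<real>\<^sub>\<le>\<^sub>0"
  hence "x\<^sup>2 - y\<^sup>2 - 4 * real m * \<rho> \<le> 0" "2 * x * y = 0"
    unfolding complex_nonpos_Reals_iff by (auto simp: x_def y_def power2_eq_square)
  with x less show False by auto
qed

lemma MMm_sqrt_exists:
  assumes "\<rho> > 0"
  shows "MMm_sqrt m \<rho>
           (\<lambda>\<theta>. csqrt ((\<theta> + of_nat m + of_real \<rho>)\<^sup>2 - 4 * of_nat m * of_real \<rho>))"
  unfolding MMm_sqrt_def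
proof (intro conjI allI impI)
  show "(\<lambda>\<theta>. csqrt ((\<theta> + of_nat m + of_real \<rho>)\<^sup>2 - 4 * of_nat m * of_real \<rho>))
          holomorphic_on {\<theta>. Re \<theta> > 0}"
    using MMm_sqrt_radicand[OF assms] by (intro holomorphic_intros) auto
next
  fix x :: real assume x: "x > 0"
  define r where "r = (x + real m + \<rho>)\<^sup>2 - 4 * real m * \<rho>"
  have eq: "(complex_of_real x + of_nat m + of_real \<rho>)\<^sup>2 - 4 * of_nat m * of_real \<rho> = of_real r"
    by (simp add: r_def)
  have "r > 0"
    using MMm_sqrt_radicand[OF assms, of "of_real x" m] x unfolding eq by force
  thus "\<exists>y>0. csqrt ((complex_of_real x + of_nat m + of_real \<rho>)\<^sup>2
                - 4 * of_nat m * of_real \<rho>) = complex_of_real y"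
    unfolding eq by (intro exI[of _ "sqrt r"]) simp
qed simp

lemma MMm_sqrt_unique:
  assumes "\<rho> > 0" "MMm_sqrt m \<rho> S" "MMm_sqrt m \<rho> T" "Re \<theta> > 0"
  shows "S \<theta> = T \<theta>"
proof -
  let ?H = "{\<theta>::complex. Re \<theta> > 0}"
  let ?R = "\<lambda>\<theta>::complex. (\<theta> + of_nat m + of_real \<rho>)\<^sup>2 - 4 * of_nat m * of_real \<rho>"
  have S: "(S z)\<^sup>2 = ?R z" and T: "(T z)\<^sup>2 = ?R z" if "Re z > 0" for z
    using assms(2,3) that by (auto simp: MMm_sqrt_def)
  have Tne: "T z \<noteq> 0" if "Re z > 0" for z
    using T[OF that] MMm_sqrt_radicand[OF assms(1) that, of m] by auto
  have sq: "S z / T z \<in> {1, -1}" if "Re z > 0" for z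
  proof -
    have "(S z / T z)\<^sup>2 = 1"
      using S[OF that] T[OF that] Tne[OF that] by (metis div_self power_divide power_not_zero)
    thus ?thesis by (auto simp: power2_eq_1_iff)
  qed
  have conn: "connected ?H"
    by (intro convex_connected convex_halfspace_Re_gt)
  have cont: "continuous_on ?H (\<lambda>z. S z / T z)"
    using assms(2,3) Tne
    by (intro continuous_intros) (auto simp: MMm_sqrt_def holomorphic_on_imp_continuous_on)
  have "(\<lambda>z. S z / T z) constant_on ?H"
  proof (rule continuous_finite_range_constant[OF conn cont])
    show "finite ((\<lambda>z. S z / T z) ` ?H)"
      by (rule finite_subset[of _ "{1, -1}"]) (use sq in blast)+
  qed
  then obtain c where c: "\<And>z. Re z > 0 \<Longrightarrow> S z / T z = c"
    unfolding constant_on_def by auto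
  obtain u v where uv: "u > 0" "S 1 = complex_of_real u" "v > 0" "T 1 = complex_of_real v"
    using assms(2,3) unfolding MMm_sqrt_def by (metis of_real_1 zero_less_one)
  have "c = complex_of_real (u / v)" using c[of 1] uv by simp
  hence "Re c > 0" using uv by simp
  moreover have "c \<in> {1, -1}" using c[of 1] sq[of 1] by auto
  ultimately have "c = 1" by auto
  thus ?thesis using c[OF assms(4)] Tne[OF assms(4)] by simp
qed

text \<open>The argument \<open>s\<close> is the value of the square root at \<open>\<theta>\<close>.\<close>

definition Z_plus :: "nat \<Rightarrow> real \<Rightarrow> complex \<Rightarrow> complex \<Rightarrow> complex" where
  "Z_plus m \<rho> s \<theta> = 1 / (2 * of_real \<rho>) * (of_real \<rho> + \<theta> + of_nat m + s)"

definition Z_minus :: "nat \<Rightarrow> real \<Rightarrow> complex \<Rightarrow> complex \<Rightarrow> complex" where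
  "Z_minus m \<rho> s \<theta> = 1 / (2 * of_real \<rho>) * (of_real \<rho> + \<theta> + of_nat m - s)"

text \<open>
  The integral does not depend on the radius \<open>r < 1\<close> of the circle, by \<open>F_fun_circle\<close> below.
  For complex exponents \<open>powr\<close> is the principal branch.
\<close>

definition F_fun :: "real \<Rightarrow> nat \<Rightarrow> complex \<Rightarrow> complex" where
  "F_fun \<rho> n \<theta> = 1 / (2 * of_real pi * \<i>) *
     contour_integral (circlepath 0 (1/2))
       (\<lambda>z. exp (of_real \<rho> * z) / (z ^ (n + 1) * (1 - z) powr \<theta>))"

lemma contour_integral_circle_eq_sum:
  assumes r: "0 < r" "r < 1"
  shows "1 / (2 * of_real pi * \<i>) *
           contour_integral (circlepath 0 r)
             (\<lambda>z. exp (of_real \<rho> * z) / (z ^ (n + 1) * (1 - z) powr \<theta>)) =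
         (\<Sum>l=0..n. of_real \<rho> ^ (n - l) / (fact (n - l) * fact l) * pochhammer \<theta> l)"
proof -
  define f where "f = (\<lambda>z. exp (of_real \<rho> * z) * (1 + (- z)) powr (- \<theta>))"
  have nonpos: "1 + (- z) \<notin> \<real>\<^sub>\<le>\<^sub>0" if "norm z < 1" for z :: complex
  proof
    assume "1 + (- z) \<in> \<real>\<^sub>\<le>\<^sub>0"
    hence "Re z \<ge> 1" by (simp add: complex_nonpos_Reals_iff)
    with complex_Re_le_cmod[of z] that show False by simp
  qed
  have hol: "f holomorphic_on ball 0 1"
    unfolding f_def using nonpos by (intro holomorphic_intros) auto
  have "((\<lambda>x. (1 + x) powr (- \<theta>)) \<circ> (\<lambda>x. - x)) has_fps_expansion
          (fps_binomial (- \<theta>) oo (- fps_X))"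
    by (intro has_fps_expansion_compose has_fps_expansion_binomial_complex fps_expansion_intros) auto
  hence "f has_fps_expansion (fps_exp (of_real \<rho>) * (fps_binomial (- \<theta>) oo (- fps_X)))"
    unfolding f_def o_def by (intro has_fps_expansion_mult has_fps_expansion_exp)
  from fps_nth_fps_expansion[OF this, of n]
  have "(deriv ^^ n) f 0 / fact n =
          (\<Sum>i=0..n. of_real \<rho> ^ i / fact i * fps_nth (fps_binomial (- \<theta>) oo (- fps_X)) (n - i))"
    by (simp add: fps_mult_nth)
  moreover have "fps_nth (fps_binomial (- \<theta>) oo (- fps_X)) l = pochhammer \<theta> l / fact l" for l
    by (simp add: fps_compose_uminus' gbinomial_pochhammer flip: power_mult_distrib mult.assoc)
  moreover have "(\<Sum>i=0..n. of_real \<rho> ^ i / fact i * (pochhammer \<theta> (n - i) / fact (n - i))) =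
        (\<Sum>l=0..n. of_real \<rho> ^ (n - l) / (fact (n - l) * fact l) * pochhammer \<theta> l)"
    by (rule sum.reindex_bij_witness[of _ "\<lambda>i. n - i" "\<lambda>i. n - i"]) auto
  ultimately have eq: "(deriv ^^ n) f 0 / fact n =
      (\<Sum>l=0..n. of_real \<rho> ^ (n - l) / (fact (n - l) * fact l) * pochhammer \<theta> l)"
    by simp
  have "contour_integral (circlepath 0 r) (\<lambda>u. f u / (u - 0) ^ Suc n) =
          2 * pi * \<i> * (deriv ^^ n) f 0 / fact n"
  proof (rule Cauchy_contour_integral_circlepath)
    show "continuous_on (cball 0 r) f"
      by (rule holomorphic_on_imp_continuous_on, rule holomorphic_on_subset[OF hol]) (use r in auto)
    show "f holomorphic_on ball 0 r"
      by (rule holomorphic_on_subset[OF hol]) (use r in auto)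
  qed (use r in auto)
  also have "(\<lambda>u. f u / (u - 0) ^ Suc n) =
               (\<lambda>z. exp (of_real \<rho> * z) / (z ^ (n + 1) * (1 - z) powr \<theta>))"
    by (simp add: f_def fun_eq_iff powr_minus field_simps)
  finally show ?thesis using eq by (simp add: field_simps)
qed

lemma F_fun_circle:
  assumes "0 < r" "r < 1"
  shows "F_fun \<rho> n \<theta> = 1 / (2 * of_real pi * \<i>) *
     contour_integral (circlepath 0 r)
       (\<lambda>z. exp (of_real \<rho> * z) / (z ^ (n + 1) * (1 - z) powr \<theta>))"
  unfolding F_fun_def
  using contour_integral_circle_eq_sum[of "1/2" \<rho> n \<theta>]
    contour_integral_circle_eq_sum[OF assms, of \<rho> n \<theta>] by simp

lemma F_fun_eq_sum:
  assumes "Re \<theta> > 0"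
  shows "F_fun \<rho> n \<theta> =
    (\<Sum>l=0..n. of_real \<rho> ^ (n - l) / (fact (n - l) * fact l) * (Gamma (\<theta> + of_nat l) / Gamma \<theta>))"
proof -
  have "\<theta> \<notin> \<int>\<^sub>\<le>\<^sub>0" using assms by (auto elim!: nonpos_Ints_cases)
  thus ?thesis
    unfolding F_fun_def using contour_integral_circle_eq_sum[of "1/2" \<rho> n \<theta>]
    by (simp add: pochhammer_Gamma)
qed

end

(* Watch the process only at the times 0, h, 2h, ... . The chain so obtained is stopped when it first
   reaches or passes K; since the rates only allow unit steps, it takes the values u(i) of a solution of
   the backward equations theta u(i) = sum_j q(i,j) u(j), i < K, u(K) = 1, to a discounted martingale up
   to an error o(h) per step, and it jumps over K with probability o(h) per step. Discounting leaves
   about 1 / (h Re theta) effective steps, so the total error tends to 0 with h. By right-continuity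
   the first visit to K on the grid converges to the hitting time, hence the transform is u. The stated
   formula is the explicit solution: below m through the recursion of the F_n, above m
   through the two roots Z of rho Z^2 - (rho + theta + m) Z + m = 0. *)
theory Submission
  imports Defs
begin

section \<open>A discrete-time chain watched until it reaches or passes \<open>K\<close>\<close>

lemma (in prob_space) prob_less_eq_sum:
  fixes X :: "'a \<Rightarrow> nat"
  assumes [measurable]: "X \<in> measurable M (count_space UNIV)" "Measurable.pred M Q"
  shows "prob {\<omega>\<in>space M. Q \<omega> \<and> X \<omega> < K} = (\<Sum>v<K. prob {\<omega>\<in>space M. Q \<omega> \<and> X \<omega> = v})"
proof -
  have "{\<omega>\<in>space M. Q \<omega> \<and> X \<omega> < K} = (\<Union>v<K. {\<omega>\<in>space M. Q \<omega> \<and> X \<omega> = v})" by auto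
  then show ?thesis
    by (simp only:) (rule finite_measure_finite_Union, auto simp: disjoint_family_on_def)
qed

text \<open>The Markov property is stated in product form, so that it also makes sense on null
  cylinders. In the application \<open>X\<close> is the process on the grid of mesh \<open>h\<close>
  and \<open>p\<close> is \<open>P h\<close>.\<close>

locale grid_chain = prob_space +
  fixes X :: "nat \<Rightarrow> 'a \<Rightarrow> nat" and p :: "nat \<Rightarrow> nat \<Rightarrow> real" and K :: nat
  assumes X_measurable [measurable]: "X k \<in> measurable M (count_space UNIV)"
    and cylinder: "prob {\<omega>\<in>space M. \<forall>l\<le>Suc k. X l \<omega> = xs l} =
          prob {\<omega>\<in>space M. \<forall>l\<le>k. X l \<omega> = xs l} * p (xs k) (xs (Suc k))"
    and start_le: "prob {\<omega>\<in>space M. K < X 0 \<omega>} = 0"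
begin

text \<open>For \<open>j < K\<close> this is the sub-stochastic law of the chain killed on leaving
  \<open>{..<K}\<close>; for \<open>j = K\<close> it is the probability that the first passage out
  of \<open>{..<K}\<close> happens at time \<open>k\<close> and lands exactly on
  \<open>K\<close>.\<close>

definition taboo :: "nat \<Rightarrow> nat \<Rightarrow> real" where
  "taboo k j = prob {\<omega>\<in>space M. (\<forall>l<k. X l \<omega> < K) \<and> X k \<omega> = j}"

definition overshoot :: "nat \<Rightarrow> real" where
  "overshoot k = prob {\<omega>\<in>space M. (\<forall>l<k. X l \<omega> < K) \<and> K < X k \<omega>}"

text \<open>Extends the product formula from exact cylinders to events that only bound an initial
  segment of the path. The initial coordinates are released one at a time: a coordinate known only
  to be below \<open>K\<close> is split over its finitely many values.\<close>

lemma cylinder_mixed: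
  assumes "r \<le> k"
  shows "prob {\<omega>\<in>space M. (\<forall>l<r. X l \<omega> < K) \<and> (\<forall>l\<in>{r..Suc k}. X l \<omega> = xs l)} =
    prob {\<omega>\<in>space M. (\<forall>l<r. X l \<omega> < K) \<and> (\<forall>l\<in>{r..k}. X l \<omega> = xs l)} * p (xs k) (xs (Suc k))"
  using assms
proof (induction r arbitrary: xs)
  case 0
  then show ?case using cylinder[of k xs] by (simp add: atLeast0AtMost Ball_def)
next
  case (Suc r)
  have split: "prob {\<omega>\<in>space M. (\<forall>l<Suc r. X l \<omega> < K) \<and> (\<forall>l\<in>{Suc r..q}. X l \<omega> = xs l)} =
      (\<Sum>v<K. prob {\<omega>\<in>space M. (\<forall>l<r. X l \<omega> < K) \<and> (\<forall>l\<in>{r..q}. X l \<omega> = (xs(r := v)) l)})"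
    if "r \<le> q" for q
  proof -
    have "{\<omega>\<in>space M. (\<forall>l<Suc r. X l \<omega> < K) \<and> (\<forall>l\<in>{Suc r..q}. X l \<omega> = xs l)} =
        {\<omega>\<in>space M. ((\<forall>l<r. X l \<omega> < K) \<and> (\<forall>l\<in>{Suc r..q}. X l \<omega> = xs l)) \<and> X r \<omega> < K}"
      by (auto simp: less_Suc_eq)
    moreover have "{\<omega>\<in>space M. ((\<forall>l<r. X l \<omega> < K) \<and> (\<forall>l\<in>{Suc r..q}. X l \<omega> = xs l)) \<and> X r \<omega> = v} =
        {\<omega>\<in>space M. (\<forall>l<r. X l \<omega> < K) \<and> (\<forall>l\<in>{r..q}. X l \<omega> = (xs(r := v)) l)}" for v
      using atLeastAtMost_insertL[OF that, symmetric] by auto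
    ultimately show ?thesis by (simp only:) (subst prob_less_eq_sum, auto)
  qed
  \<comment> \<open>Both sides are sums over the value \<open>v\<close> at \<open>r\<close>. Since
    \<open>Suc r \<le> k\<close>, the update at \<open>r\<close> leaves \<open>xs k\<close> and
    \<open>xs (Suc k)\<close> alone, so the factor \<open>p\<close> is common to all
    summands.\<close>
  show ?case
    using Suc.prems by (simp add: split Suc.IH sum_distrib_right del: fun_upd_apply)
      (simp add: sum_distrib_right)
qed

lemma taboo_step_one: "prob {\<omega>\<in>space M. ((\<forall>l<k. X l \<omega> < K) \<and> X (Suc k) \<omega> = j) \<and> X k \<omega> = i} = taboo k i * p i j"
proof -
  let ?xs = "\<lambda>l. if l = k then i else j"
  have "{\<omega>\<in>space M. ((\<forall>l<k. X l \<omega> < K) \<and> X (Suc k) \<omega> = j) \<and> X k \<omega> = i} =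
      {\<omega>\<in>space M. (\<forall>l<k. X l \<omega> < K) \<and> (\<forall>l\<in>{k..Suc k}. X l \<omega> = ?xs l)}"
    by (auto simp: le_Suc_eq)
  then show ?thesis
    using cylinder_mixed[of k k ?xs] by (simp add: taboo_def)
qed

lemma taboo_Suc: "taboo (Suc k) j = (\<Sum>i<K. taboo k i * p i j)"
proof -
  have "taboo (Suc k) j = prob {\<omega>\<in>space M. ((\<forall>l<k. X l \<omega> < K) \<and> X (Suc k) \<omega> = j) \<and> X k \<omega> < K}"
    unfolding taboo_def by (rule arg_cong[where f = prob]) (auto simp: less_Suc_eq)
  also have "\<dots> = (\<Sum>i<K. prob {\<omega>\<in>space M. ((\<forall>l<k. X l \<omega> < K) \<and> X (Suc k) \<omega> = j) \<and> X k \<omega> = i})"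
    by (rule prob_less_eq_sum) measurable
  also have "\<dots> = (\<Sum>i<K. taboo k i * p i j)"
    by (simp only: taboo_step_one)
  finally show ?thesis .
qed

lemma taboo_nonneg: "0 \<le> taboo k j"
  by (simp add: taboo_def)

lemma sum_taboo_eq: "(\<Sum>i<L. taboo k i) = prob {\<omega>\<in>space M. (\<forall>l<k. X l \<omega> < K) \<and> X k \<omega> < L}"
  unfolding taboo_def by (subst prob_less_eq_sum) auto

lemma sum_taboo_le: "(\<Sum>i<L. taboo k i) \<le> 1"
  by (simp add: sum_taboo_eq)

text \<open>Computed through the complement, as the mass below \<open>K\<close> at time
  \<open>k\<close> minus the mass that lands in \<open>{..K}\<close>; this avoids an infinite sum
  over targets above \<open>K\<close>.\<close>

lemma overshoot_Suc: "overshoot (Suc k) = (\<Sum>i<K. taboo k i * (1 - (\<Sum>j\<le>K. p i j)))"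
proof -
  have "overshoot (Suc k) + prob {\<omega>\<in>space M. (\<forall>l<Suc k. X l \<omega> < K) \<and> X (Suc k) \<omega> < Suc K} =
     prob {\<omega>\<in>space M. \<forall>l<Suc k. X l \<omega> < K}"
    unfolding overshoot_def
    by (subst finite_measure_Union[symmetric]) (auto intro!: arg_cong[where f = prob])
  also have "prob {\<omega>\<in>space M. \<forall>l<Suc k. X l \<omega> < K} = (\<Sum>i<K. taboo k i)"
    unfolding sum_taboo_eq by (rule arg_cong[where f = prob]) (auto simp: less_Suc_eq)
  finally have "overshoot (Suc k) = (\<Sum>i<K. taboo k i) - (\<Sum>j\<le>K. \<Sum>i<K. taboo k i * p i j)"
    by (simp only: sum_taboo_eq[symmetric] taboo_Suc lessThan_Suc_atMost)
  also have "(\<Sum>j\<le>K. \<Sum>i<K. taboo k i * p i j) = (\<Sum>i<K. taboo k i * (\<Sum>j\<le>K. p i j))"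
    by (subst sum.swap) (simp add: sum_distrib_left)
  finally show ?thesis by (simp add: right_diff_distrib sum_subtractf)
qed

text \<open>The weights \<open>taboo k i\<close> with \<open>i < K\<close> are nonnegative of total
  mass at most 1, so a uniform error per row survives averaging.\<close>

lemma norm_sum_taboo_le:
  fixes r :: "nat \<Rightarrow> 'b :: real_normed_vector"
  assumes "\<And>i. i < K \<Longrightarrow> norm (r i) \<le> \<epsilon>" "0 \<le> \<epsilon>"
  shows "norm (\<Sum>i<K. taboo k i *\<^sub>R r i) \<le> \<epsilon>"
proof -
  have "norm (\<Sum>i<K. taboo k i *\<^sub>R r i) \<le> (\<Sum>i<K. taboo k i * \<epsilon>)"
    by (rule sum_norm_le) (auto intro!: mult_left_mono assms simp: taboo_nonneg)
  also have "\<dots> \<le> 1 * \<epsilon>"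
    unfolding sum_distrib_right[symmetric] by (intro mult_right_mono sum_taboo_le assms)
  finally show ?thesis by simp
qed

text \<open>Each \<open>overshoot k\<close> is at most \<open>\<epsilon>\<close>: at time 0 by
  \<open>start_le\<close>, later because it averages the row defects. Discounting turns this into a
  geometric series.\<close>

lemma overshoot_bound:
  fixes x :: real
  assumes x: "0 \<le> x" "x < 1" and eps: "0 \<le> \<epsilon>"
    and row: "\<And>i. i < K \<Longrightarrow> \<bar>1 - (\<Sum>j\<le>K. p i j)\<bar> \<le> \<epsilon>"
  shows "(\<Sum>k. x ^ k * overshoot k) \<le> \<epsilon> / (1 - x)"
proof -
  have le: "overshoot k \<le> \<epsilon>" for k
  proof (cases k)
    case 0
    then show ?thesis using start_le eps by (simp add: overshoot_def)
  next
    case (Suc k')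
    then show ?thesis
      using norm_sum_taboo_le[of "\<lambda>i. 1 - (\<Sum>j\<le>K. p i j)" \<epsilon> k'] row eps by (simp add: overshoot_Suc)
  qed
  have nn: "0 \<le> overshoot k" for k by (simp add: overshoot_def)
  have sm: "summable (\<lambda>k. x ^ k * \<epsilon>)"
    using x by (intro summable_mult2 summable_geometric) auto
  have s: "summable (\<lambda>k. x ^ k * overshoot k)"
    by (rule summable_comparison_test'[OF sm, of 0]) (use x nn le in \<open>auto intro!: mult_left_mono\<close>)
  have "(\<Sum>k. x ^ k * overshoot k) \<le> (\<Sum>k. x ^ k * \<epsilon>)"
    by (rule suminf_le[OF _ s sm]) (use x le in \<open>auto intro!: mult_left_mono\<close>)
  also have "\<dots> = \<epsilon> / (1 - x)"
    using x by (subst suminf_mult2[symmetric]) (auto simp: suminf_geometric summable_geometric)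
  finally show ?thesis .
qed

text \<open>If \<open>u\<close> were exactly harmonic for the discounted chain,
  \<open>z ^ k * u (X k)\<close> stopped at \<open>K\<close> would be a martingale. Here
  \<open>a k\<close> is its mean over paths still below \<open>K\<close>; as \<open>u K = 1\<close>,
  the mass absorbed at each step is a telescoping difference plus an error \<open>e k\<close> of
  norm at most \<open>\<epsilon>\<close>.\<close>

lemma hit_transform_bound:
  fixes z :: complex and u :: "nat \<Rightarrow> complex"
  assumes z: "norm z < 1" and eps: "0 \<le> \<epsilon>" and uK: "u K = 1"
    and row: "\<And>i. i < K \<Longrightarrow> norm (z * (\<Sum>j\<le>K. of_real (p i j) * u j) - u i) \<le> \<epsilon>"
  shows "norm ((\<Sum>k. z ^ k * of_real (taboo k K)) - (\<Sum>i\<le>K. of_real (taboo 0 i) * u i)) \<le> \<epsilon> / (1 - norm z)"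
proof -
  define a where "a k = (\<Sum>i<K. of_real (taboo k i) * u i)" for k
  define e where "e k = (\<Sum>i<K. taboo k i *\<^sub>R (z * (\<Sum>j\<le>K. of_real (p i j) * u j) - u i))" for k
  have e_le: "norm (e k) \<le> \<epsilon>" for k
    unfolding e_def by (rule norm_sum_taboo_le) (auto intro: row eps)
  have "(\<Sum>j\<le>K. of_real (taboo (Suc k) j) * u j) = a (Suc k) + of_real (taboo (Suc k) K)" for k
    by (simp add: a_def uK flip: lessThan_Suc_atMost)
  moreover have "z * (\<Sum>j\<le>K. of_real (taboo (Suc k) j) * u j) = a k + e k" for k
  proof -
    have "(\<Sum>j\<le>K. of_real (taboo (Suc k) j) * u j) =
        (\<Sum>j\<le>K. \<Sum>i<K. of_real (taboo k i) * (of_real (p i j) * u j))"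
      by (simp add: taboo_Suc sum_distrib_right mult.assoc)
    also have "\<dots> = (\<Sum>i<K. of_real (taboo k i) * (\<Sum>j\<le>K. of_real (p i j) * u j))"
      by (subst sum.swap) (simp add: sum_distrib_left)
    finally show ?thesis
      by (simp add: a_def e_def scaleR_conv_of_real sum_distrib_left mult.assoc mult.left_commute
          right_diff_distrib sum_subtractf)
  qed
  ultimately have "z * (a (Suc k) + of_real (taboo (Suc k) K)) = a k + e k" for k by simp
  moreover have "z ^ Suc k * of_real (taboo (Suc k) K) =
      z ^ k * (z * (a (Suc k) + of_real (taboo (Suc k) K))) - z ^ Suc k * a (Suc k)" for k
    by (simp add: algebra_simps)
  ultimately have step: "z ^ Suc k * of_real (taboo (Suc k) K) =
      (z ^ k * a k - z ^ Suc k * a (Suc k)) + z ^ k * e k" for k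
    by (simp add: distrib_left)
  have sm: "summable (\<lambda>k. norm z ^ k * \<epsilon>)"
    using z by (intro summable_mult2 summable_geometric) auto
  \<comment> \<open>The inserted 0 keeps the set nonempty for \<open>K = 0\<close> and the bound
    nonnegative.\<close>
  have a_bound: "norm (a k) \<le> Max (insert 0 ((\<lambda>i. norm (u i)) ` {..<K}))" for k
    using norm_sum_taboo_le[of u "Max (insert 0 ((\<lambda>i. norm (u i)) ` {..<K}))" k]
    by (simp add: a_def scaleR_conv_of_real)
  have "(\<lambda>k. z ^ k * a k) \<longlonglongrightarrow> 0"
  proof (rule Lim_null_comparison)
    show "\<forall>\<^sub>F k in sequentially. norm (z ^ k * a k) \<le>
        norm z ^ k * Max (insert 0 ((\<lambda>i. norm (u i)) ` {..<K}))"
      by (auto simp: norm_mult norm_power intro!: always_eventually mult_left_mono a_bound)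
    show "(\<lambda>k. norm z ^ k * Max (insert 0 ((\<lambda>i. norm (u i)) ` {..<K}))) \<longlonglongrightarrow> 0"
      using z by (intro tendsto_mult_left_zero LIMSEQ_power_zero) auto
  qed
  then have tel: "(\<lambda>k. z ^ k * a k - z ^ Suc k * a (Suc k)) sums (a 0)"
    using telescope_sums'[of "\<lambda>k. z ^ k * a k" 0] by simp
  have ne: "norm (z ^ k * e k) \<le> norm z ^ k * \<epsilon>" for k
    by (auto simp: norm_mult norm_power intro!: mult_left_mono e_le)
  have se: "summable (\<lambda>k. z ^ k * e k)"
    by (rule summable_comparison_test'[OF sm ne])
  have "(\<lambda>k. z ^ Suc k * of_real (taboo (Suc k) K)) sums (a 0 + (\<Sum>k. z ^ k * e k))"
    unfolding step by (intro sums_add tel summable_sums se)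
  \<comment> \<open>Shifting the index brings in the paths that start at \<open>K\<close>; together
    with \<open>a 0\<close> they make up the full initial average of \<open>u\<close> over
    \<open>{..K}\<close>.\<close>
  then have "(\<lambda>k. z ^ k * of_real (taboo k K)) sums (a 0 + (\<Sum>k. z ^ k * e k) + of_real (taboo 0 K))"
    by (subst (asm) sums_Suc_iff) simp
  then have "(\<Sum>k. z ^ k * of_real (taboo k K)) - (\<Sum>i\<le>K. of_real (taboo 0 i) * u i) = (\<Sum>k. z ^ k * e k)"
    by (simp add: sums_iff a_def uK flip: lessThan_Suc_atMost)
  also have "norm \<dots> \<le> (\<Sum>k. norm z ^ k * \<epsilon>)"
    by (rule norm_suminf_le[OF ne sm])
  also have "\<dots> = \<epsilon> / (1 - norm z)"
    using z by (subst suminf_mult2[symmetric]) (auto simp: suminf_geometric summable_geometric)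
  finally show ?thesis .
qed

section \<open>The discounted first visit to \<open>K\<close>: pathwise comparison and
  expectation\<close>

text \<open>In contrast to \<open>taboo k K\<close>, a visit to \<open>K\<close> after a jump over
  \<open>K\<close> counts as well. This is the variable that converges to the discounted hitting
  time.\<close>

definition hit_discount :: "complex \<Rightarrow> 'a \<Rightarrow> complex" where
  "hit_discount z \<omega> = (if \<exists>k. X k \<omega> = K then z ^ (LEAST k. X k \<omega> = K) else 0)"

lemma hit_discount_measurable [measurable]: "hit_discount z \<in> borel_measurable M"
proof -
  have [measurable]: "(\<lambda>\<omega>. LEAST k. X k \<omega> = K) \<in> measurable M (count_space UNIV)"
    by (rule measurable_Least) measurable
  have "(\<lambda>\<omega>. z ^ (LEAST k. X k \<omega> = K)) \<in> borel_measurable M"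
    by (rule measurable_compose[of _ _ "count_space UNIV"]) auto
  then show ?thesis unfolding hit_discount_def by measurable
qed

lemma norm_hit_discount_le: "norm z \<le> 1 \<Longrightarrow> norm (hit_discount z \<omega>) \<le> 1"
  by (auto simp: hit_discount_def norm_power power_le_one)

text \<open>At most one of the events \<open>H k\<close> and \<open>V k\<close> occurs, namely at
  the first time \<open>s\<close> with \<open>K \<le> X s \<omega>\<close>. On \<open>H s\<close>
  the two discounts agree; on \<open>V s\<close> a visit to \<open>K\<close> can only come later, so
  the discount is at most \<open>norm z ^ s\<close>.\<close>

lemma hit_discount_minus_hit_le:
  fixes z :: complex
  assumes "norm z < 1"
  defines "H \<equiv> \<lambda>k. {\<omega>\<in>space M. (\<forall>l<k. X l \<omega> < K) \<and> X k \<omega> = K}"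
    and "V \<equiv> \<lambda>k. {\<omega>\<in>space M. (\<forall>l<k. X l \<omega> < K) \<and> K < X k \<omega>}"
  assumes \<omega>: "\<omega> \<in> space M"
  shows "summable (\<lambda>k. norm (indicator (H k) \<omega> *\<^sub>R z ^ k))" (is ?A)
    "summable (\<lambda>k. norm (indicator (V k) \<omega> *\<^sub>R norm z ^ k))" (is ?B)
    "norm (hit_discount z \<omega> - (\<Sum>k. indicator (H k) \<omega> *\<^sub>R z ^ k)) \<le> (\<Sum>k. indicator (V k) \<omega> *\<^sub>R norm z ^ k)" (is ?C)
proof -
  show ?A
    by (rule summable_comparison_test'[of "\<lambda>k. norm z ^ k" 0])
      (use assms(1) in \<open>auto simp: norm_power indicator_def intro!: summable_geometric\<close>)
  show ?B
    by (rule summable_comparison_test'[of "\<lambda>k. norm z ^ k" 0])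
      (use assms(1) in \<open>auto simp: norm_power indicator_def intro!: summable_geometric\<close>)
  show ?C
  proof (cases "\<exists>k. K \<le> X k \<omega>")
    case False
    then have "\<omega> \<notin> H k" "\<omega> \<notin> V k" "X k \<omega> \<noteq> K" for k
      by (auto simp: H_def V_def not_le) (metis less_irrefl less_trans)+
    then show ?thesis by (simp add: hit_discount_def)
  next
    case True
    define s where "s = (LEAST k. K \<le> X k \<omega>)"
    have Xs: "K \<le> X s \<omega>" unfolding s_def by (rule LeastI_ex[OF True])
    have below: "X l \<omega> < K" if "l < s" for l
      using not_less_Least[of l "\<lambda>k. K \<le> X k \<omega>"] that by (simp add: s_def not_le)
    have uniq: "k = s" if "\<forall>l<k. X l \<omega> < K" "K \<le> X k \<omega>" for k
      using that below Xs by (metis linorder_neqE_nat not_le)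
    have off: "\<omega> \<notin> H k" "\<omega> \<notin> V k" if "k \<noteq> s" for k
      using uniq[of k] that by (auto simp: H_def V_def)
    have sumH: "(\<Sum>k. indicator (H k) \<omega> *\<^sub>R z ^ k) = indicator (H s) \<omega> *\<^sub>R z ^ s"
      by (rule trans[OF suminf_finite[of "{s}"]]) (simp, simp add: off, subst sum.insert, simp_all)
    have sumO: "(\<Sum>k. indicator (V k) \<omega> *\<^sub>R norm z ^ k) = indicator (V s) \<omega> *\<^sub>R norm z ^ s"
      by (rule trans[OF suminf_finite[of "{s}"]]) (simp, simp add: off, subst sum.insert, simp_all)
    have late: "s \<le> k" if "X k \<omega> = K" for k
      using below[of k] that by (meson less_irrefl not_le)
    show ?thesis
    proof (cases "X s \<omega> = K")
      case True
      have "(LEAST k. X k \<omega> = K) = s"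
        by (rule Least_equality) (auto intro: True late)
      then have "hit_discount z \<omega> = z ^ s" using True by (auto simp: hit_discount_def)
      moreover have "\<omega> \<in> H s" using True below \<omega> by (simp add: H_def)
      ultimately show ?thesis unfolding sumH sumO by simp
    next
      case False
      then have mem: "\<omega> \<in> V s" "\<omega> \<notin> H s" using Xs below \<omega> by (auto simp: H_def V_def)
      have "norm (hit_discount z \<omega>) \<le> norm z ^ s"
      proof (cases "\<exists>k. X k \<omega> = K")
        case True
        then show ?thesis
          using late[OF LeastI_ex[OF True]] assms(1) by (simp add: hit_discount_def norm_power power_decreasing)
      qed (simp add: hit_discount_def)
      then show ?thesis using mem unfolding sumH sumO by simp
    qed
  qed
qed

text \<open>Two errors of size \<open>\<epsilon> / (1 - norm z)\<close> add up: jumps over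
  \<open>K\<close>, controlled by the row sums over \<open>{..K}\<close>, and the failure of
  \<open>u\<close> to be exactly harmonic.\<close>

lemma expectation_hit_discount_bound:
  fixes z :: complex and u :: "nat \<Rightarrow> complex"
  assumes z: "norm z < 1" and eps: "0 \<le> \<epsilon>" and uK: "u K = 1"
    and row1: "\<And>i. i < K \<Longrightarrow> \<bar>1 - (\<Sum>j\<le>K. p i j)\<bar> \<le> \<epsilon>"
    and row2: "\<And>i. i < K \<Longrightarrow> norm (z * (\<Sum>j\<le>K. of_real (p i j) * u j) - u i) \<le> \<epsilon>"
  shows "norm (expectation (hit_discount z) - (\<Sum>i\<le>K. of_real (taboo 0 i) * u i)) \<le> 2 * \<epsilon> / (1 - norm z)"
proof -
  define H where "H k = {\<omega>\<in>space M. (\<forall>l<k. X l \<omega> < K) \<and> X k \<omega> = K}" for k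
  define V where "V k = {\<omega>\<in>space M. (\<forall>l<k. X l \<omega> < K) \<and> K < X k \<omega>}" for k
  note pw = hit_discount_minus_hit_le[OF z, folded H_def V_def]
  have [measurable]: "H k \<in> sets M" "V k \<in> sets M" for k
    unfolding H_def V_def by measurable
  have gm: "summable (\<lambda>k. norm z ^ k)" using z by (intro summable_geometric) auto
  have intH: "integrable M (\<lambda>\<omega>. indicator (H k) \<omega> *\<^sub>R z ^ k)" for k
    by (intro integrable_scaleR_left integrable_real_indicator) (auto simp: emeasure_eq_measure)
  have intO: "integrable M (\<lambda>\<omega>. indicator (V k) \<omega> *\<^sub>R norm z ^ k)" for k
    by (intro integrable_scaleR_left integrable_real_indicator) (auto simp: emeasure_eq_measure)
  have normH: "(\<integral>\<omega>. norm (indicator (H k) \<omega> *\<^sub>R z ^ k) \<partial>M) = prob (H k) * norm z ^ k" for k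
    by (simp add: norm_power)
  have normO: "(\<integral>\<omega>. norm (indicator (V k) \<omega> *\<^sub>R norm z ^ k) \<partial>M) = prob (V k) * norm z ^ k" for k
    by (simp add: norm_power)
  \<comment> \<open>Domination by the geometric series in \<open>norm z\<close> justifies the
    exchange of series and expectation.\<close>
  have sH: "summable (\<lambda>k. \<integral>\<omega>. norm (indicator (H k) \<omega> *\<^sub>R z ^ k) \<partial>M)"
    unfolding normH by (rule summable_comparison_test'[OF gm, of 0]) (auto intro!: mult_left_le_one_le)
  have sO: "summable (\<lambda>k. \<integral>\<omega>. norm (indicator (V k) \<omega> *\<^sub>R norm z ^ k) \<partial>M)"
    unfolding normO by (rule summable_comparison_test'[OF gm, of 0]) (auto intro!: mult_left_le_one_le)
  have aeH: "AE \<omega> in M. summable (\<lambda>k. norm (indicator (H k) \<omega> *\<^sub>R z ^ k))"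
    and aeO: "AE \<omega> in M. summable (\<lambda>k. norm (indicator (V k) \<omega> *\<^sub>R norm z ^ k))"
    using pw(1,2) by (auto intro!: AE_I2)
  note iH = integrable_suminf[OF intH aeH sH] integral_suminf[OF intH aeH sH]
  note iO = integrable_suminf[OF intO aeO sO] integral_suminf[OF intO aeO sO]
  have intT: "integrable M (hit_discount z)"
    by (rule integrable_const_bound[of _ 1]) (use norm_hit_discount_le z in auto)
  have "norm (expectation (hit_discount z) - (\<integral>\<omega>. (\<Sum>k. indicator (H k) \<omega> *\<^sub>R z ^ k) \<partial>M)) \<le>
      (\<integral>\<omega>. (\<Sum>k. indicator (V k) \<omega> *\<^sub>R norm z ^ k) \<partial>M)"
    unfolding Bochner_Integration.integral_diff[OF intT iH(1), symmetric]
    by (rule order_trans[OF integral_norm_bound])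
      (intro integral_mono integrable_norm Bochner_Integration.integrable_diff intT iH(1) iO(1) pw(3))
  moreover have "(\<integral>\<omega>. (\<Sum>k. indicator (H k) \<omega> *\<^sub>R z ^ k) \<partial>M) = (\<Sum>k. z ^ k * of_real (taboo k K))"
    unfolding iH(2) by (simp add: taboo_def H_def scaleR_conv_of_real mult.commute)
  moreover have "(\<integral>\<omega>. (\<Sum>k. indicator (V k) \<omega> *\<^sub>R norm z ^ k) \<partial>M) = (\<Sum>k. norm z ^ k * overshoot k)"
    unfolding iO(2) by (simp add: overshoot_def V_def mult.commute)
  moreover have "(\<Sum>k. norm z ^ k * overshoot k) \<le> \<epsilon> / (1 - norm z)"
    by (rule overshoot_bound) (use z eps row1 in auto)
  moreover have "norm ((\<Sum>k. z ^ k * of_real (taboo k K)) - (\<Sum>i\<le>K. of_real (taboo 0 i) * u i)) \<le> \<epsilon> / (1 - norm z)"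
    by (rule hit_transform_bound[of z \<epsilon> u, OF z eps uK row2])
  ultimately have "norm ((expectation (hit_discount z) - (\<Sum>k. z ^ k * of_real (taboo k K))) +
      ((\<Sum>k. z ^ k * of_real (taboo k K)) - (\<Sum>i\<le>K. of_real (taboo 0 i) * u i))) \<le> \<epsilon> / (1 - norm z) + \<epsilon> / (1 - norm z)"
    by (intro norm_triangle_mono) auto
  then show ?thesis by simp
qed

end

section \<open>Uniqueness for the backward equations\<close>

text \<open>Maximum principle: at a maximiser of \<open>norm (G i)\<close> with \<open>i < K\<close> the recursion forces \<open>Re \<theta> * norm (G i) \<le> 0\<close>.\<close>

lemma birth_death_recursion_unique:
  fixes G :: "nat \<Rightarrow> complex" and b d :: "nat \<Rightarrow> real"
  assumes \<theta>: "Re \<theta> > 0" and nn: "\<And>i. 0 \<le> b i" "\<And>i. 0 \<le> d i"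
    and rec: "\<And>i. i < K \<Longrightarrow>
      (\<theta> + of_real (b i) + of_real (d i)) * G i = of_real (b i) * G (Suc i) + of_real (d i) * G (i - 1)"
    and GK: "G K = 0" and "n \<le> K"
  shows "G n = 0"
proof -
  obtain i where i: "i \<in> {..K}" "\<And>j. j \<in> {..K} \<Longrightarrow> norm (G j) \<le> norm (G i)"
  proof -
    have "Max ((\<lambda>j. norm (G j)) ` {..K}) \<in> (\<lambda>j. norm (G j)) ` {..K}"
      by (rule Max_in) auto
    then obtain i where "i \<in> {..K}" "Max ((\<lambda>j. norm (G j)) ` {..K}) = norm (G i)" by blast
    then show thesis
      using that[of i] Max_ge[of "(\<lambda>j. norm (G j)) ` {..K}"] by auto
  qed
  have "norm (G i) = 0"
  proof (cases "i < K")
    case True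
    have "(Re \<theta> + b i + d i) * norm (G i) \<le> norm (\<theta> + of_real (b i) + of_real (d i)) * norm (G i)"
      using complex_Re_le_cmod[of "\<theta> + of_real (b i) + of_real (d i)"]
      by (intro mult_right_mono) auto
    also have "\<dots> = norm (of_real (b i) * G (Suc i) + of_real (d i) * G (i - 1))"
      by (simp add: norm_mult[symmetric] rec[OF True])
    also have "\<dots> \<le> b i * norm (G (Suc i)) + d i * norm (G (i - 1))"
      by (rule norm_triangle_le) (simp add: norm_mult nn)
    also have "\<dots> \<le> b i * norm (G i) + d i * norm (G i)"
      using True by (intro add_mono mult_left_mono i nn) auto
    finally have "Re \<theta> * norm (G i) \<le> 0" by (simp add: algebra_simps)
    then show ?thesis using \<theta> by (simp add: mult_le_0_iff)
  next
    case False
    then show ?thesis using i(1) GK by simp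
  qed
  then show ?thesis using i(2)[of n] \<open>n \<le> K\<close> by simp
qed

section \<open>The recursion of the \<open>F_fun\<close> and the explicit solution of the backward
  equations\<close>

lemma F_fun_pochhammer:
  "F_fun \<rho> n \<theta> = (\<Sum>l=0..n. of_real \<rho> ^ (n - l) / (fact (n - l) * fact l) * pochhammer \<theta> l)"
  unfolding F_fun_def by (rule contour_integral_circle_eq_sum) auto

lemma F_fun_0: "F_fun \<rho> 0 \<theta> = 1"
  by (simp add: F_fun_pochhammer)

text \<open>The generating function \<open>f(z) = exp (\<rho> z) (1 - z) powr (- \<theta>)\<close> of the \<open>F_fun \<rho> n \<theta>\<close>
  satisfies \<open>(1 - z) f' = (\<rho> (1 - z) + \<theta>) f\<close>.\<close>

lemma F_fun_recursion:
  "(\<theta> + of_real \<rho> + of_nat n) * F_fun \<rho> n \<theta> =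
     of_nat (Suc n) * F_fun \<rho> (Suc n) \<theta> + (if n = 0 then 0 else of_real \<rho> * F_fun \<rho> (n - 1) \<theta>)"
proof -
  \<comment> \<open>The binomial series of \<open>(1 - z) powr (- \<theta>)\<close>. Its
    differential equation \<open>(1 - z) B' = \<theta> B\<close> encodes the step from
    \<open>pochhammer \<theta> l\<close> to \<open>pochhammer \<theta> (Suc l)\<close>.\<close>
  define B where "B = Abs_fps (\<lambda>l. pochhammer \<theta> l / fact l)"
  define f where "f = B * fps_exp (of_real \<rho>)"
  have F: "F_fun \<rho> k \<theta> = fps_nth f k" for k
    unfolding F_fun_pochhammer f_def fps_mult_nth by (intro sum.cong) (auto simp: B_def mult.commute)
  have "(1 - fps_X) * fps_deriv B = fps_const \<theta> * B"
  proof (rule fps_ext)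
    fix l
    have "of_nat (Suc l) * (pochhammer \<theta> (Suc l) / fact (Suc l)) = (\<theta> + of_nat l) * (pochhammer \<theta> l / fact l)" for l
      by (simp add: pochhammer_Suc field_simps del: of_nat_Suc)
    then have s: "fps_nth (fps_deriv B) l = (\<theta> + of_nat l) * (pochhammer \<theta> l / fact l)" for l
      by (simp add: B_def del: of_nat_Suc)
    have t: "fps_nth (fps_deriv B) (l - 1) = of_nat l * (pochhammer \<theta> l / fact l)" if "l \<noteq> 0"
      using that by (simp add: B_def)
    show "fps_nth ((1 - fps_X) * fps_deriv B) l = fps_nth (fps_const \<theta> * B) l"
    proof -
      have "fps_nth ((1 - fps_X) * fps_deriv B) l =
          fps_nth (fps_deriv B) l - (if l = 0 then 0 else fps_nth (fps_deriv B) (l - 1))"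
        by (simp add: left_diff_distrib)
      also have "\<dots> = \<theta> * (pochhammer \<theta> l / fact l)"
        by (cases "l = 0") (simp_all only: s[of l] s[of 0] t if_True if_False refl not_False_eq_True, simp_all add: algebra_simps add_divide_distrib)
      finally show ?thesis by (simp add: B_def)
    qed
  qed
  moreover have "(1 - fps_X) * fps_deriv f = ((1 - fps_X) * fps_deriv B) * fps_exp (of_real \<rho>)
      + (1 - fps_X) * (fps_const (of_real \<rho>) * f)"
    by (simp add: f_def algebra_simps)
  ultimately have "(1 - fps_X) * fps_deriv f = fps_const \<theta> * f + (1 - fps_X) * (fps_const (of_real \<rho>) * f)"
    by (simp add: f_def mult.assoc)
  \<comment> \<open>Comparing coefficients of order \<open>n\<close> in the differential equation of
    \<open>f\<close> gives the three-term recursion.\<close>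
  then have "fps_nth ((1 - fps_X) * fps_deriv f) n =
      fps_nth (fps_const \<theta> * f + (1 - fps_X) * (fps_const (of_real \<rho>) * f)) n" by simp
  then show ?thesis
    by (cases n) (auto simp: F left_diff_distrib algebra_simps)
qed

text \<open>Below \<open>m\<close> the factor \<open>fact n / r ^ n\<close> turns the recursion of
  \<open>F\<close> into the backward equations; above \<open>m\<close> the coefficients are constant
  and powers of the two characteristic roots solve them. The combination \<open>high\<close> is
  chosen to match \<open>low\<close> at \<open>m\<close> and at \<open>Suc m\<close>, so the
  equation at \<open>m\<close> holds too. The form \<open>r ^ m / r ^ n\<close> keeps
  \<open>low (Suc m)\<close> correct, where \<open>r ^ (m - n)\<close> would be truncated.\<close>

lemma MMm_recursion_solution:
  fixes r \<theta> s :: complex and m :: nat and F :: "nat \<Rightarrow> complex"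
  assumes r: "r \<noteq> 0"
    and s: "s\<^sup>2 = (\<theta> + of_nat m + r)\<^sup>2 - 4 * of_nat m * r"
    and Zp: "Zp = 1 / (2 * r) * (r + \<theta> + of_nat m + s)"
    and Zm: "Zm = 1 / (2 * r) * (r + \<theta> + of_nat m - s)"
    and F: "\<And>n. (\<theta> + r + of_nat n) * F n = of_nat (Suc n) * F (Suc n) + (if n = 0 then 0 else r * F (n - 1))"
  defines "low \<equiv> \<lambda>n. r ^ m / r ^ n * (fact n / fact m) * (s * F n)"
    and "high \<equiv> \<lambda>k. r * F m * (Zp * Zm ^ k - Zm * Zp ^ k) + of_nat (m + 1) * F (m + 1) * (Zp ^ k - Zm ^ k)"
  defines "G \<equiv> \<lambda>n. if n \<le> m then low n else high (n - m)"
  shows "G m = high 0"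
    and "(\<theta> + r + of_nat (min n m)) * G n = r * G (Suc n) + of_nat (min n m) * G (n - 1)"
proof -
  have diff: "r * (Zp - Zm) = s"
    using r by (simp add: Zp Zm field_simps)
  show Gm: "G m = high 0"
    using r by (simp add: G_def low_def high_def) (simp flip: diff add: algebra_simps)
  have low_rec: "(\<theta> + r + of_nat n) * low n = r * low (Suc n) + of_nat n * low (n - 1)" for n
  proof -
    have "r * low (Suc n) = r ^ m / r ^ n * (fact n / fact m) * s * (of_nat (Suc n) * F (Suc n))"
      using r by (simp add: low_def field_simps)
    moreover have "of_nat n * low (n - 1) = r ^ m / r ^ n * (fact n / fact m) * s * (if n = 0 then 0 else r * F (n - 1))"
      using r by (cases n) (simp_all add: low_def field_simps)
    moreover have "(\<theta> + r + of_nat n) * low n = r ^ m / r ^ n * (fact n / fact m) * s * ((\<theta> + r + of_nat n) * F n)"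
      by (simp add: low_def algebra_simps)
    ultimately show ?thesis by (simp only: F distrib_left)
  qed
  have high1: "high 1 = low (Suc m)"
    using r by (simp add: high_def low_def field_simps) (simp flip: diff add: algebra_simps)
  \<comment> \<open>\<open>Zp\<close> and \<open>Zm\<close> solve the characteristic quadratic:
    complete the square and insert the value of \<open>s\<^sup>2\<close>.\<close>
  have root: "r * (Z * Z) + of_nat m = (\<theta> + r + of_nat m) * Z" if "Z \<in> {Zp, Zm}" for Z
  proof -
    have "(2 * r * Z - (r + \<theta> + of_nat m))\<^sup>2 = s\<^sup>2"
      using that r by (auto simp: Zp Zm)
    then have "4 * r * (r * (Z * Z) + of_nat m) = 4 * r * ((\<theta> + r + of_nat m) * Z)"
      unfolding s by (simp add: power2_eq_square algebra_simps)
    then show ?thesis using r by simp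
  qed
  have root': "r * Z ^ Suc (Suc k) + of_nat m * Z ^ k = (\<theta> + r + of_nat m) * Z ^ Suc k"
    if "Z \<in> {Zp, Zm}" for Z k
    using arg_cong[OF root[OF that], of "\<lambda>x. x * Z ^ k"] by (simp add: algebra_simps)
  have high_rec: "(\<theta> + r + of_nat m) * high (Suc k) = r * high (Suc (Suc k)) + of_nat m * high k" for k
  proof -
    have h: "high k = (r * F m * Zp - of_nat (m + 1) * F (m + 1)) * Zm ^ k
        + (of_nat (m + 1) * F (m + 1) - r * F m * Zm) * Zp ^ k" for k
      by (simp add: high_def algebra_simps)
    \<comment> \<open>Superposition for a linear three-term recursion, applied to the powers of
      \<open>Zm\<close> and \<open>Zp\<close>.\<close>
    have lin: "e * (\<alpha> * A1 + \<beta> * B1) = r * (\<alpha> * A2 + \<beta> * B2) + c * (\<alpha> * A0 + \<beta> * B0)"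
      if "r * A2 + c * A0 = e * A1" "r * B2 + c * B0 = e * B1"
      for e c \<alpha> \<beta> A0 A1 A2 B0 B1 B2 :: complex
    proof -
      have "e * (\<alpha> * A1 + \<beta> * B1) = \<alpha> * (e * A1) + \<beta> * (e * B1)"
        by (simp add: algebra_simps)
      then show ?thesis unfolding that[symmetric] by (simp add: algebra_simps)
    qed
    show ?thesis
      unfolding h by (rule lin) (rule root', simp)+
  qed
  have upper: "G (m + k) = high k" for k
    using Gm by (cases k) (auto simp: G_def)
  consider "n < m" | "n = m" | k where "n = m + Suc k"
    by (metis add_Suc_right less_imp_add_positive linorder_neqE_nat not0_implies_Suc less_irrefl)
  then show "(\<theta> + r + of_nat (min n m)) * G n = r * G (Suc n) + of_nat (min n m) * G (n - 1)"
  proof cases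
    case 1
    then show ?thesis using low_rec[of n] by (auto simp: G_def min_def)
  next
    \<comment> \<open>At the junction the equation is the one for \<open>low\<close>, with
      \<open>high 1\<close> standing in for \<open>low (Suc m)\<close>.\<close>
    case 2
    then show ?thesis using low_rec[of m] upper[of 1] high1 by (simp add: G_def)
  next
    case 3
    then show ?thesis using high_rec[of k] upper[of "Suc k"] upper[of "Suc (Suc k)"] upper[of k] by (simp add: min_def)
  qed
qed

section \<open>From first visits on a grid to the hitting time\<close>

text \<open>After the hitting time \<open>t\<close> the path stays at \<open>K\<close> on some
  \<open>[t, b)\<close>. As soon as the mesh is below \<open>b - t\<close>, a grid point falls into
  this interval, and the first grid visit lies between \<open>t\<close> and \<open>t + h l\<close>.
  A path that never visits \<open>K\<close> gives 0 on both sides.\<close>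

lemma tendsto_first_grid_hit:
  fixes h :: "nat \<Rightarrow> real" and N :: "real \<Rightarrow> 'w \<Rightarrow> nat"
  assumes h: "\<And>l. h l > 0" "h \<longlonglongrightarrow> 0"
    and cont: "\<And>t. t \<ge> 0 \<Longrightarrow> continuous (at_right t) (\<lambda>s. N s \<omega>)"
  shows "(\<lambda>l. if \<exists>k. N (real k * h l) \<omega> = K
           then exp (- \<theta> * of_real (h l)) ^ (LEAST k. N (real k * h l) \<omega> = K) else 0)
         \<longlonglongrightarrow> exp_discount \<theta> (hitting_time N K \<omega>)"
proof (cases "\<exists>t\<ge>0. N t \<omega> = K")
  case False
  then have "{t. 0 \<le> t \<and> N t \<omega> = K} = {}" by auto
  then have "hitting_time N K \<omega> = \<infinity>"
    by (simp only: hitting_time_def) (simp add: top_ereal_def)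
  moreover have "N (real k * h l) \<omega> \<noteq> K" for k l
    using False h(1)[of l] by auto
  ultimately show ?thesis by (simp add: exp_discount_def)
next
  case True
  obtain t where t: "t \<ge> 0" "N t \<omega> = K" "hitting_time N K \<omega> = ereal t"
    using hitting_time_attained[of N \<omega> K] cont True by blast
  have "((\<lambda>s. N s \<omega>) \<longlongrightarrow> N t \<omega>) (at_right t)"
    using cont[OF t(1)] by (simp add: continuous_within)
  then have "eventually (\<lambda>s. N s \<omega> = N t \<omega>) (at_right t)"
    by (simp add: tendsto_discrete)
  then obtain b where b: "b > t" "\<And>s. t < s \<Longrightarrow> s < b \<Longrightarrow> N s \<omega> = K"
    unfolding eventually_at_right_field t(2) by blast
  define k where "k l = (LEAST k. N (real k * h l) \<omega> = K)" for l
  have hit: "(\<exists>k. N (real k * h l) \<omega> = K) \<and> t \<le> real (k l) * h l \<and> real (k l) * h l \<le> t + h l"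
    if "h l < b - t" for l
  proof -
    \<comment> \<open>The index of the first grid point at or after \<open>t\<close>.\<close>
    define q where "q = nat \<lceil>t / h l\<rceil>"
    have "0 \<le> t / h l" using t(1) h(1)[of l] by simp
    then have "real q = of_int \<lceil>t / h l\<rceil>" unfolding q_def by (intro of_nat_nat) linarith
    then have "t / h l \<le> real q" "real q < t / h l + 1" by linarith+
    then have q: "t \<le> real q * h l" "real q * h l < t + h l"
      using h(1)[of l] by (auto simp: field_simps)
    then have Nq: "N (real q * h l) \<omega> = K"
      using b(2)[of "real q * h l"] that t(2) by (cases "t = real q * h l") auto
    then have Nk: "N (real (k l) * h l) \<omega> = K" unfolding k_def by (rule LeastI)
    have "ereal t \<le> ereal (real (k l) * h l)"
      unfolding t(3)[symmetric] hitting_time_def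
      by (rule INF_lower) (use Nk h(1)[of l] in auto)
    then have "t \<le> real (k l) * h l" by simp
    moreover have "k l \<le> q" unfolding k_def by (rule Least_le) (rule Nq)
    then have "real (k l) * h l \<le> real q * h l" using h(1)[of l] by simp
    then have "real (k l) * h l \<le> t + h l" using q(2) by linarith
    ultimately show ?thesis using Nq by blast
  qed
  have ev: "\<forall>\<^sub>F l in sequentially. h l < b - t"
    using b(1) by (intro order_tendstoD(2)[OF h(2)]) simp
  have lim: "(\<lambda>l. real (k l) * h l) \<longlonglongrightarrow> t"
  proof (rule tendsto_sandwich[of "\<lambda>_. t" _ _ "\<lambda>l. t + h l"])
    show "(\<lambda>l. t + h l) \<longlonglongrightarrow> t" using tendsto_add[OF tendsto_const h(2), of t] by simp
  qed (use ev hit in \<open>auto elim!: eventually_mono\<close>)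
  have "(\<lambda>l. exp (- \<theta> * of_real (real (k l) * h l))) \<longlonglongrightarrow> exp (- \<theta> * of_real t)"
    by (intro tendsto_intros lim)
  moreover have "\<forall>\<^sub>F l in sequentially. exp (- \<theta> * of_real (real (k l) * h l)) =
     (if \<exists>k. N (real k * h l) \<omega> = K then exp (- \<theta> * of_real (h l)) ^ (LEAST k. N (real k * h l) \<omega> = K) else 0)"
    using ev
  proof eventually_elim
    case (elim l)
    have "exp (- \<theta> * of_real (real (k l) * h l)) = exp (- \<theta> * of_real (h l)) ^ k l"
      by (simp add: exp_of_nat_mult[symmetric] mult_ac)
    then show ?case using hit[OF elim] by (simp add: k_def)
  qed
  ultimately show ?thesis
    by (simp add: exp_discount_def t(3) tendsto_cong)
qed

section \<open>The Markov process sampled on a grid\<close>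

text \<open>The conditional probability in \<open>markov_process\<close> is specified only for
  events of positive probability; for a null cylinder both sides vanish by monotonicity.\<close>

lemma markov_process_cylinder:
  assumes mp: "markov_process M P N" and h: "h > 0"
  shows "measure M {\<omega>\<in>space M. \<forall>l\<le>Suc k. N (real l * h) \<omega> = xs l} =
     measure M {\<omega>\<in>space M. \<forall>l\<le>k. N (real l * h) \<omega> = xs l} * P h (xs k) (xs (Suc k))"
proof -
  have step: "\<P>(\<omega> in M. N (ts (Suc k)) \<omega> = ys (Suc k) \<bar> \<forall>i\<le>k. N (ts i) \<omega> = ys i) =
      P (ts (Suc k) - ts k) (ys k) (ys (Suc k))"
    if "0 \<le> ts 0" "\<forall>i\<le>k. ts i < ts (Suc i)"
      "measure M {\<omega>\<in>space M. \<forall>i\<le>k. N (ts i) \<omega> = ys i} > 0"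
    for ts :: "nat \<Rightarrow> real" and ys
    using mp that unfolding markov_process_def by presburger
  interpret prob_space M using mp by (simp add: markov_process_def)
  have [measurable]: "N (real l * h) \<in> measurable M (count_space UNIV)" for l
    using mp h by (simp add: markov_process_def)
  let ?C = "{\<omega>\<in>space M. \<forall>l\<le>k. N (real l * h) \<omega> = xs l}"
  have eq: "{\<omega>\<in>space M. \<forall>l\<le>Suc k. N (real l * h) \<omega> = xs l} =
      {\<omega>\<in>space M. N (real (Suc k) * h) \<omega> = xs (Suc k) \<and> (\<forall>l\<le>k. N (real l * h) \<omega> = xs l)}"
    by (auto simp: le_Suc_eq)
  show ?thesis
  proof (cases "prob ?C = 0")
    case True
    have "prob {\<omega>\<in>space M. \<forall>l\<le>Suc k. N (real l * h) \<omega> = xs l} \<le> prob ?C"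
      by (rule finite_measure_mono) auto
    then show ?thesis using True by (simp add: measure_le_0_iff)
  next
    case False
    then have pos: "prob ?C > 0" by (simp add: zero_less_measure_iff)
    have grid: "0 \<le> real 0 * h" "\<forall>i\<le>k. real i * h < real (Suc i) * h" using h by auto
    have "\<P>(\<omega> in M. N (real (Suc k) * h) \<omega> = xs (Suc k) \<bar> \<forall>l\<le>k. N (real l * h) \<omega> = xs l) =
        P (real (Suc k) * h - real k * h) (xs k) (xs (Suc k))"
      by (rule step) (use grid pos in auto)
    moreover have "real (Suc k) * h - real k * h = h" by (simp add: algebra_simps)
    ultimately show ?thesis
      using pos by (simp only: cond_prob_def eq) (simp add: field_simps)
  qed
qed

text \<open>Conditioning on the initial state keeps the cylinders with \<open>xs 0 = n\<close>,
  rescaled by a common factor, and annihilates the others, so the product formula persists.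
  \<open>n \<le> K\<close> excludes a start above \<open>K\<close>.\<close>

lemma grid_chain_conditioned:
  assumes mp: "markov_process M P N" and h: "h > 0"
    and pos: "measure M {\<omega>\<in>space M. N 0 \<omega> = n} > 0" and "n \<le> K"
  shows "grid_chain (uniform_measure M {\<omega>\<in>space M. N 0 \<omega> = n}) (\<lambda>k. N (real k * h)) (P h) K"
proof -
  interpret prob_space M using mp by (simp add: markov_process_def)
  let ?A = "{\<omega>\<in>space M. N 0 \<omega> = n}"
  have meas: "N t \<in> measurable M (count_space UNIV)" if "t \<ge> 0" for t
    using mp that by (simp add: markov_process_def)
  have [measurable]: "N (real l * h) \<in> measurable M (count_space UNIV)" for l
    using meas h by simp
  have [measurable]: "N 0 \<in> measurable M (count_space UNIV)" by (rule meas) simp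
  have emA: "emeasure M ?A \<noteq> 0" "emeasure M ?A < \<infinity>"
    using pos by (auto simp: emeasure_eq_measure)
  have um: "measure (uniform_measure M ?A) B = prob (?A \<inter> B) / prob ?A" if "B \<in> sets M" for B
    using that emA by (intro measure_uniform_measure) auto
  show ?thesis
  proof (intro grid_chain.intro grid_chain_axioms.intro, goal_cases)
    case 1
    show ?case using emA by (intro prob_space_uniform_measure) auto
  next
    case (2 k)
    show ?case by (subst measurable_cong_sets[of _ M _ "count_space UNIV"]) auto
  next
    case (3 k xs)
    have start: "N 0 \<omega> = xs 0" if "\<forall>l\<le>j. N (real l * h) \<omega> = xs l" for \<omega> j
      using that[rule_format, of 0] by simp
    have cyl: "prob (?A \<inter> {\<omega>\<in>space M. \<forall>l\<le>j. N (real l * h) \<omega> = xs l}) =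
        (if xs 0 = n then prob {\<omega>\<in>space M. \<forall>l\<le>j. N (real l * h) \<omega> = xs l} else 0)" for j
    proof (cases "xs 0 = n")
      case True
      then have "?A \<inter> {\<omega>\<in>space M. \<forall>l\<le>j. N (real l * h) \<omega> = xs l} = {\<omega>\<in>space M. \<forall>l\<le>j. N (real l * h) \<omega> = xs l}"
        using start by auto
      then show ?thesis using True by simp
    next
      case False
      then have "?A \<inter> {\<omega>\<in>space M. \<forall>l\<le>j. N (real l * h) \<omega> = xs l} = {}"
        using start by auto
      then show ?thesis using False by simp
    qed
    show ?case
      unfolding space_uniform_measure
      by (subst (1 2) um) (auto simp: cyl markov_process_cylinder[OF mp h] simp del: of_nat_Suc)
  next
    case 4
    have "?A \<inter> {\<omega>\<in>space M. K < N (real 0 * h) \<omega>} = {}" using \<open>n \<le> K\<close> by auto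
    then show ?case
      unfolding space_uniform_measure by (subst um) (auto simp: measure_empty)
  qed
qed

section \<open>Small-time behaviour of the transition function\<close>

lemma has_vector_derivative_0_imp_little_o:
  fixes f :: "real \<Rightarrow> 'a :: real_normed_vector"
  assumes "(f has_vector_derivative 0) (at_right 0)" "\<And>l. h l > 0" "h \<longlonglongrightarrow> 0"
  shows "(\<lambda>l. norm (f (h l) - f 0) / h l) \<longlonglongrightarrow> 0"
proof -
  have "((\<lambda>y. (1 / norm (y - 0)) *\<^sub>R (f y - (f 0 + (y - 0) *\<^sub>R 0))) \<longlongrightarrow> 0) (at_right 0)"
    using assms(1) unfolding has_vector_derivative_def has_derivative_within by auto
  moreover have "filterlim h (at_right 0) sequentially"
    using assms(2,3) less_imp_neq[OF assms(2)] by (auto simp: filterlim_at intro!: always_eventually)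
  ultimately have "(\<lambda>l. (1 / norm (h l - 0)) *\<^sub>R (f (h l) - (f 0 + (h l - 0) *\<^sub>R 0))) \<longlonglongrightarrow> 0"
    by (rule filterlim_compose)
  from tendsto_norm[OF this] show ?thesis
    using assms(2) by (simp add: less_imp_le divide_inverse_commute abs_of_pos)
qed

text \<open>Only finitely many targets occur, so the entrywise rates suffice with the product rule.
  The derivative vanishes exactly when \<open>u\<close> satisfies the backward equation at
  \<open>i\<close>, up to targets beyond \<open>K\<close>.\<close>

lemma weighted_transition_derivative:
  fixes u :: "nat \<Rightarrow> complex"
  assumes "has_rates P q" "transition_function P" "i \<le> K"
  shows "((\<lambda>h. exp (- \<theta> * of_real h) * (\<Sum>j\<le>K. of_real (P h i j) * u j)) has_vector_derivative
     ((\<Sum>j\<le>K. of_real (q i j) * u j) - \<theta> * u i)) (at_right 0)"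
proof -
  have P0: "P 0 i j = (if i = j then 1 else 0)" for j
    using assms(2) by (simp add: transition_function_def)
  have "((\<lambda>h. of_real (P h i j) :: complex) has_vector_derivative of_real (q i j)) (at_right 0)" for j
    using assms(1) by (intro has_vector_derivative_of_real) (simp add: has_rates_def)
  then have "((\<lambda>h. \<Sum>j\<le>K. of_real (P h i j) * u j) has_vector_derivative (\<Sum>j\<le>K. of_real (q i j) * u j)) (at_right 0)"
    by (intro has_vector_derivative_sum has_vector_derivative_mult_left)
  moreover have "((\<lambda>h. exp (- \<theta> * of_real h)) has_vector_derivative - \<theta>) (at_right 0)"
    by (rule has_vector_derivative_real_field) (auto intro!: derivative_eq_intros)
  ultimately have "((\<lambda>h. exp (- \<theta> * of_real h) * (\<Sum>j\<le>K. of_real (P h i j) * u j)) has_vector_derivative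
     exp (- \<theta> * of_real 0) * (\<Sum>j\<le>K. of_real (q i j) * u j) + - \<theta> * (\<Sum>j\<le>K. of_real (P 0 i j) * u j)) (at_right 0)"
    by (rule has_vector_derivative_mult[rotated])
  moreover have "(\<Sum>j\<le>K. of_real (P 0 i j) * u j) = u i"
    using assms(3) by (simp add: P0 if_distrib[of of_real] if_distrib[of "\<lambda>x. x * _"] sum.delta' cong: if_cong)
  ultimately show ?thesis by simp
qed

lemma sum_birth_death_rate:
  fixes u :: "nat \<Rightarrow> complex"
  assumes "i < K" "d 0 = 0"
  shows "(\<Sum>j\<le>K. of_real (birth_death_rate b d i j) * u j) =
    of_real (b i) * u (Suc i) + of_real (d i) * u (i - 1) - of_real (b i + d i) * u i"
proof -
  have "(\<Sum>j\<le>K. of_real (birth_death_rate b d i j) * u j) =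
      (\<Sum>j\<in>{i - 1, i, Suc i}. of_real (birth_death_rate b d i j) * u j)"
    by (rule sum.mono_neutral_right) (use assms in \<open>auto simp: birth_death_rate_def\<close>)
  also have "\<dots> = of_real (b i) * u (Suc i) + of_real (d i) * u (i - 1) - of_real (b i + d i) * u i"
    using assms(2) by (cases i) (auto simp: birth_death_rate_def algebra_simps)
  finally show ?thesis .
qed

section \<open>Identification of the hitting-time transform\<close>

text \<open>The transform is not shown to satisfy the backward equations itself. It is the limit of
  grid expectations, each within \<open>2 * \<epsilon> l / (1 - norm (z l))\<close> of the given
  solution \<open>u n\<close>.\<close>

lemma Q_hat_birth_death:
  fixes u :: "nat \<Rightarrow> complex"
  assumes bd: "birth_death_process M b d N" and d0: "d 0 = 0" and \<theta>: "Re \<theta> > 0"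
    and uK: "u K = 1"
    and rec: "\<And>i. i < K \<Longrightarrow>
      (\<theta> + of_real (b i) + of_real (d i)) * u i = of_real (b i) * u (Suc i) + of_real (d i) * u (i - 1)"
    and n: "n \<le> K" and pos: "measure M {\<omega>\<in>space M. N 0 \<omega> = n} > 0"
  shows "Q_hat M N K n \<theta> = u n"
proof -
  obtain P where tf: "transition_function P" and hr: "has_rates P (birth_death_rate b d)"
    and mp: "markov_process M P N"
    using bd by (auto simp: birth_death_process_def)
  define h where "h l = inverse (real (Suc l))" for l
  have h: "h l > 0" "h \<longlonglongrightarrow> 0" for l
    unfolding h_def[abs_def] by (simp, rule LIMSEQ_inverse_real_of_nat)
  let ?U = "uniform_measure M {\<omega>\<in>space M. N 0 \<omega> = n}"
  have P0: "P 0 i j = (if i = j then 1 else 0)" for i j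
    using tf by (simp add: transition_function_def)
  define z where "z l = exp (- \<theta> * of_real (h l))" for l
  \<comment> \<open>Used twice: with \<open>\<theta>\<close> and \<open>u\<close> it measures the
    martingale defect, with 0 and the constant 1 it is the row sum over \<open>{..K}\<close>, hence
    measures jumps beyond \<open>K\<close>.\<close>
  define \<phi> where "\<phi> \<theta> u i h = exp (- \<theta> * of_real h) * (\<Sum>j\<le>K. of_real (P h i j) * u j)"
    for \<theta> :: complex and u i and h :: real
  have \<phi>0: "\<phi> \<theta> u i 0 = u i" if "i \<le> K" for \<theta> u i
    using that by (simp add: \<phi>_def P0 if_distrib[of of_real] if_distrib[of "\<lambda>x. x * _"] sum.delta' cong: if_cong)
  have lim: "(\<lambda>l. norm (\<phi> \<theta>' v i (h l) - v i) / h l) \<longlonglongrightarrow> 0"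
    if "i < K" "(\<theta>' + of_real (b i) + of_real (d i)) * v i = of_real (b i) * v (Suc i) + of_real (d i) * v (i - 1)"
    for \<theta>' v i
  proof -
    have "(\<Sum>j\<le>K. of_real (birth_death_rate b d i j) * v j) - \<theta>' * v i = 0"
      using that(2) unfolding sum_birth_death_rate[of i K d b v, OF that(1) d0] by (simp add: algebra_simps)
    then have "(\<phi> \<theta>' v i has_vector_derivative 0) (at_right 0)"
      using weighted_transition_derivative[OF hr tf, of i K \<theta>' v] that(1) by (simp add: \<phi>_def[abs_def])
    from has_vector_derivative_0_imp_little_o[OF this h] show ?thesis
      using that(1) by (simp add: \<phi>0)
  qed
  define \<epsilon> where "\<epsilon> l = (\<Sum>i<K. norm (\<phi> 0 (\<lambda>_. 1) i (h l) - 1) + norm (\<phi> \<theta> u i (h l) - u i))" for l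
  have \<epsilon>_lim: "(\<lambda>l. \<epsilon> l / h l) \<longlonglongrightarrow> 0"
    \<comment> \<open>Both instances are \<open>o(h)\<close>: \<open>u\<close> satisfies the
      equations by assumption, and the constant 1 satisfies them with 0 in place of
      \<open>\<theta>\<close>.\<close>
    unfolding \<epsilon>_def sum_divide_distrib add_divide_distrib
    by (intro tendsto_null_sum tendsto_add_zero lim) (auto simp: rec)
  have nz: "norm (z l) = exp (- Re \<theta> * h l)" for l
    by (simp add: z_def norm_exp_eq_Re)
  \<comment> \<open>Shows that \<open>1 - norm (z l)\<close> is asymptotic to
    \<open>Re \<theta> * h l\<close>, so that an \<open>o(h)\<close> error per step remains
    negligible after division by it.\<close>
  have "((\<lambda>x. exp (- Re \<theta> * x)) has_real_derivative - Re \<theta>) (at 0)"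
    by (auto intro!: derivative_eq_intros)
  then have "((\<lambda>x. (exp (- Re \<theta> * x) - 1) / x) \<longlongrightarrow> - Re \<theta>) (at 0)"
    by (simp add: has_field_derivative_iff)
  moreover have "filterlim h (at 0) sequentially"
    using h by (auto simp: filterlim_at intro!: always_eventually less_imp_neq[symmetric])
  ultimately have "(\<lambda>l. (exp (- Re \<theta> * h l) - 1) / h l) \<longlonglongrightarrow> - Re \<theta>"
    by (rule filterlim_compose)
  from tendsto_minus[OF this] have dz: "(\<lambda>l. (1 - norm (z l)) / h l) \<longlonglongrightarrow> Re \<theta>"
    by (simp add: nz diff_divide_distrib)
  have bound_lim: "(\<lambda>l. 2 * \<epsilon> l / (1 - norm (z l))) \<longlonglongrightarrow> 0"
  proof -
    have "(\<lambda>l. 2 * (\<epsilon> l / h l) / ((1 - norm (z l)) / h l)) \<longlonglongrightarrow> 2 * 0 / Re \<theta>"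
      using \<theta> by (intro tendsto_intros \<epsilon>_lim dz) auto
    moreover have "2 * (\<epsilon> l / h l) / ((1 - norm (z l)) / h l) = 2 * \<epsilon> l / (1 - norm (z l))" for l
      using h(1)[of l] by simp
    ultimately show ?thesis by (simp only: mult_zero_right div_0)
  qed
  define T where "T l \<omega> = (if \<exists>k. N (real k * h l) \<omega> = K
           then z l ^ (LEAST k. N (real k * h l) \<omega> = K) else 0)" for l \<omega>
  have chain: "grid_chain ?U (\<lambda>k. N (real k * h l)) (P (h l)) K" for l
    by (rule grid_chain_conditioned[OF mp h(1) pos n])
  have T_eq: "grid_chain.hit_discount (\<lambda>k. N (real k * h l)) K (z l) = T l" for l
    by (simp add: fun_eq_iff grid_chain.hit_discount_def[OF chain] T_def)
  have z1: "norm (z l) < 1" for l using \<theta> h(1)[of l] by (simp add: nz)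
  \<comment> \<open>Under the conditional measure the initial law is the point mass at
    \<open>n\<close>.\<close>
  have init: "(\<Sum>i\<le>K. of_real (grid_chain.taboo ?U (\<lambda>k. N (real k * h l)) K 0 i) * u i) = u n" for l
  proof -
    interpret grid_chain ?U "\<lambda>k. N (real k * h l)" "P (h l)" K by (rule chain)
    have meas: "N 0 \<in> measurable M (count_space UNIV)" using mp by (simp add: markov_process_def)
    interpret M: prob_space M using mp by (simp add: markov_process_def)
    have "taboo 0 i = (if i = n then 1 else 0)" for i
    proof -
      have [measurable]: "N 0 \<in> measurable M (count_space UNIV)" by (rule meas)
      have "taboo 0 i = M.prob ({\<omega>\<in>space M. N 0 \<omega> = n} \<inter> {\<omega>\<in>space M. N 0 \<omega> = i}) / M.prob {\<omega>\<in>space M. N 0 \<omega> = n}"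
        using pos by (simp add: taboo_def, subst measure_uniform_measure) (auto simp: M.emeasure_eq_measure)
      also have "{\<omega>\<in>space M. N 0 \<omega> = n} \<inter> {\<omega>\<in>space M. N 0 \<omega> = i} = (if i = n then {\<omega>\<in>space M. N 0 \<omega> = n} else {})"
        by auto
      finally show ?thesis using pos by auto
    qed
    then show ?thesis
      using n by (simp add: if_distrib[of of_real] if_distrib[of "\<lambda>x. x * _"] sum.delta cong: if_cong)
  qed
  have est: "norm ((\<integral>\<omega>. T l \<omega> \<partial>?U) - u n) \<le> 2 * \<epsilon> l / (1 - norm (z l))" for l
  proof -
    have eps0: "0 \<le> \<epsilon> l" by (auto simp: \<epsilon>_def intro!: sum_nonneg)
    have summand: "norm (\<phi> 0 (\<lambda>_. 1) i (h l) - 1) + norm (\<phi> \<theta> u i (h l) - u i) \<le> \<epsilon> l" if "i < K" for i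
      unfolding \<epsilon>_def by (rule member_le_sum) (use that in auto)
    have r1: "\<bar>1 - (\<Sum>j\<le>K. P (h l) i j)\<bar> \<le> \<epsilon> l" if "i < K" for i
    proof -
      have "\<phi> 0 (\<lambda>_. 1) i (h l) - 1 = of_real ((\<Sum>j\<le>K. P (h l) i j) - 1)"
        by (simp add: \<phi>_def)
      then have "norm (\<phi> 0 (\<lambda>_. 1) i (h l) - 1) = \<bar>(\<Sum>j\<le>K. P (h l) i j) - 1\<bar>"
        by (simp only: norm_of_real)
      then show ?thesis
        using summand[OF that] norm_ge_zero[of "\<phi> \<theta> u i (h l) - u i"] by linarith
    qed
    have r2: "norm (z l * (\<Sum>j\<le>K. of_real (P (h l) i j) * u j) - u i) \<le> \<epsilon> l" if "i < K" for i
    proof -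
      have "norm (\<phi> \<theta> u i (h l) - u i) \<le> \<epsilon> l"
        using summand[OF that] norm_ge_zero[of "\<phi> 0 (\<lambda>_. 1) i (h l) - 1"] by linarith
      then show ?thesis by (simp only: \<phi>_def z_def)
    qed
    show ?thesis
      using grid_chain.expectation_hit_discount_bound[OF chain z1 eps0 uK r1 r2] by (simp only: T_eq init)
  qed
  have "(\<lambda>l. (\<integral>\<omega>. T l \<omega> \<partial>?U) - u n) \<longlonglongrightarrow> 0"
    by (rule Lim_null_comparison[OF _ bound_lim]) (simp add: est)
  then have lim1: "(\<lambda>l. \<integral>\<omega>. T l \<omega> \<partial>?U) \<longlonglongrightarrow> u n"
    by (simp add: LIM_zero_iff)
  have T_meas: "T l \<in> borel_measurable ?U" for l
    using grid_chain.hit_discount_measurable[OF chain, of l "z l"] by (simp only: T_eq)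
  have T_bound: "norm (T l \<omega>) \<le> 1" for l \<omega>
    using grid_chain.norm_hit_discount_le[OF chain, of "z l" l \<omega>] z1[of l] by (simp only: T_eq)
  have T_lim: "(\<lambda>l. T l \<omega>) \<longlonglongrightarrow> exp_discount \<theta> (hitting_time N K \<omega>)" if "\<omega> \<in> space ?U" for \<omega>
    unfolding T_def z_def
    by (rule tendsto_first_grid_hit[OF h]) (use mp that in \<open>auto simp: markov_process_def\<close>)
  interpret U: prob_space ?U
    using chain[of 0] by (simp add: grid_chain_def)
  \<comment> \<open>Dominated convergence with bound 1; the discounted hitting time is measurable as
    the pointwise limit of the \<open>T l\<close>.\<close>
  have "(\<lambda>l. \<integral>\<omega>. T l \<omega> \<partial>?U) \<longlonglongrightarrow> (\<integral>\<omega>. exp_discount \<theta> (hitting_time N K \<omega>) \<partial>?U)"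
    by (rule integral_dominated_convergence[where w = "\<lambda>_. 1"])
      (auto intro!: T_meas T_bound AE_I2 T_lim borel_measurable_LIMSEQ_metric[OF T_meas T_lim])
  with lim1 show ?thesis
    unfolding Q_hat_def by (rule LIMSEQ_unique[symmetric])
qed

theorem corollary5:
  fixes M :: "'w measure" and N :: "real \<Rightarrow> 'w \<Rightarrow> nat"
    and m n_star n :: nat and \<rho> :: real and \<theta> :: complex
    and S :: "complex \<Rightarrow> complex"
  assumes "m \<ge> 1" and "\<rho> > 0" and "n_star > m"
    and "MMm_queue M m \<rho> N"
    and "MMm_sqrt m \<rho> S"
    and "Re \<theta> > 0"
    and "n \<le> n_star"
    and "measure M {\<omega>\<in>space M. N 0 \<omega> = n} > 0"
  shows
    "let r = complex_of_real \<rho>;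
         F = (\<lambda>k. F_fun \<rho> k \<theta>);
         Zp = Z_plus m \<rho> (S \<theta>) \<theta>;
         Zm = Z_minus m \<rho> (S \<theta>) \<theta>
     in
       (n \<le> m \<longrightarrow>
          Q_hat M N n_star n \<theta> =
            r ^ (m - n) * (fact n / fact m) *
            (S \<theta> * F n /
              (r * F m * (Zp * Zm ^ (n_star - m) - Zm * Zp ^ (n_star - m))
               + of_nat (m + 1) * F (m + 1) * (Zp ^ (n_star - m) - Zm ^ (n_star - m))))) \<and>
       (m \<le> n \<longrightarrow>
          Q_hat M N n_star n \<theta> =
            (r * F m * (Zp * Zm ^ (n - m) - Zm * Zp ^ (n - m))
             + of_nat (m + 1) * F (m + 1) * (Zp ^ (n - m) - Zm ^ (n - m))) /
            (r * F m * (Zp * Zm ^ (n_star - m) - Zm * Zp ^ (n_star - m))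
             + of_nat (m + 1) * F (m + 1) * (Zp ^ (n_star - m) - Zm ^ (n_star - m))))"
proof -
  define r F Zp Zm where "r = complex_of_real \<rho>" and "F = (\<lambda>k. F_fun \<rho> k \<theta>)"
    and "Zp = Z_plus m \<rho> (S \<theta>) \<theta>" and "Zm = Z_minus m \<rho> (S \<theta>) \<theta>"
  note defs = this
  \<comment> \<open>\<open>high (n_star - m)\<close> is the common denominator of both claimed
    formulas, and \<open>high (n - m)\<close> the numerator of the second.\<close>
  define high where "high k = r * F m * (Zp * Zm ^ k - Zm * Zp ^ k) + of_nat (m + 1) * F (m + 1) * (Zp ^ k - Zm ^ k)" for k
  define low where "low n = r ^ m / r ^ n * (fact n / fact m) * (S \<theta> * F n)" for n
  define G where "G n = (if n \<le> m then low n else high (n - m))" for n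
  have r: "r \<noteq> 0" using assms(2) by (simp add: r_def)
  have S2: "(S \<theta>)\<^sup>2 = (\<theta> + of_nat m + r)\<^sup>2 - 4 * of_nat m * r"
    using assms(5,6) by (simp add: MMm_sqrt_def r_def)
  then have S0: "S \<theta> \<noteq> 0"
    using MMm_sqrt_radicand[OF assms(2,6), of m] by (auto simp: r_def)
  have Frec: "(\<theta> + r + of_nat n) * F n = of_nat (Suc n) * F (Suc n) + (if n = 0 then 0 else r * F (n - 1))" for n
    unfolding F_def r_def by (rule F_fun_recursion)
  note sol = MMm_recursion_solution[OF r S2 Zp_def[unfolded Z_plus_def, folded r_def] Zm_def[unfolded Z_minus_def, folded r_def] Frec]
  have Gm: "G m = high 0"
    using sol(1) by (simp add: G_def low_def high_def)
  have Grec: "(\<theta> + r + of_nat (min i m)) * G i = r * G (Suc i) + of_nat (min i m) * G (i - 1)" for i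
    using sol(2)[of i] unfolding G_def low_def high_def .
  \<comment> \<open>The denominator cannot vanish: otherwise uniqueness would force
    \<open>G 0 = 0\<close>, whereas \<open>G 0\<close> is \<open>r ^ m / fact m * S \<theta>\<close>
    because \<open>F 0 = 1\<close>, and \<open>S \<theta>\<close> is nonzero since its square avoids
    the nonpositive reals.\<close>
  have Gnz: "G n_star \<noteq> 0"
  proof
    assume "G n_star = 0"
    then have "G 0 = 0"
      using birth_death_recursion_unique[OF assms(6), of "\<lambda>_. \<rho>" "\<lambda>i. real (min i m)" n_star G 0] assms(2) Grec
      by (simp add: r_def)
    then show False using r S0 by (simp add: G_def low_def F_def F_fun_0)
  qed
  have Q: "Q_hat M N n_star n \<theta> = G n / G n_star"
  proof (rule Q_hat_birth_death)
    show "birth_death_process M (\<lambda>_. \<rho>) (\<lambda>n. real (min n m)) N"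
      using assms(4) by (simp add: MMm_queue_def)
    fix i
    show "(\<theta> + of_real \<rho> + of_real (real (min i m))) * (G i / G n_star) =
        of_real \<rho> * (G (Suc i) / G n_star) + of_real (real (min i m)) * (G (i - 1) / G n_star)"
      using arg_cong[OF Grec[of i], of "\<lambda>x. x / G n_star"] by (simp add: r_def add_divide_distrib)
  qed (use assms Gnz in auto)
  have Gs: "G n_star = high (n_star - m)"
    using assms(3) by (simp add: G_def)
  have "Q_hat M N n_star n \<theta> = r ^ (m - n) * (fact n / fact m) * (S \<theta> * F n / high (n_star - m))" if "n \<le> m"
    unfolding Q Gs using that r by (simp add: G_def low_def power_diff)
  moreover have "Q_hat M N n_star n \<theta> = high (n - m) / high (n_star - m)" if "m \<le> n"
    unfolding Q Gs using that Gm by (cases "n = m") (auto simp: G_def)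
  ultimately show ?thesis
    unfolding Let_def defs[symmetric] high_def[symmetric] by blast
qed

end
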